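(* Let $A\in\mathbb{R}^{n\times n}$, $C\in\mathbb{R}^{p\times n}$, and let $N:\mathbb{R}^n\to\mathbb{R}^{n\times n}$ be linear with $x^\top N(x)x=0$ for all $x\in\mathbb{R}^n$. Let $Q\in\mathbb{R}^{n\times n}$ be such that $N(v)v=0$ whenever $v\in\ker(Q)$. Suppose the following steps have been carried out successfully. (1) $d\in\mathbb{R}^n$ and $r>0$, such that $B_r(d)$ is invariant for $\dot x=Ax+N(x)x$, are selected using the state semidefinite program given in the context. (2) $\alpha_1,\alpha_2\ge0$ and $Y\subset\mathbb{R}^n$ with $B_r(d)\subsetneq Y$ are selected, and a positive definite $P\in\mathcal{S}^n$ and $R\in\mathbb{R}^{n\times p}$ are found such that $$P-\alpha_1I\succ0,\qquad \begin{bmatrix}\alpha_2I_n & RC\\ (RC)^\top & \alpha_2I_n\end{bmatrix}\succeq0,$$ $$PA_y+A_y^\top P+RC+C^\top R^\top\prec0\quad\text{for all }y\in Y.$$ Define $L:=P^{-1}R$. (3) $\hat d\in\mathbb{R}^n$ and $\hat r>0$, such that $B_{\hat r}(\hat d)$ is invariant for the observer $\dot{\hat x}=A\hat x+N(\hat x)\hat x-L(Cx-C\hat x)$, are selected using the observer semidefinite program given in the context. Let $x$ solve $\dot x=Ax+N(x)x$ with $x(0)=x_0\in B_r(d)$, let $\hat x$ solve the observer equation with $\hat x(0)=\hat x_0$, and let $e:=x-\hat x$. If $$\tfrac12\left[B_r(d)\oplus B_{\hat r}(\hat d)\right]\subset Y,$$ then, whenever $\hat x_0\in B_{\hat r}(\hat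 d)$, the error system $$\dot e=\left(A_{\frac{x+\hat x}{2}}+LC\right)e$$ is stable and $e(t)\to0$ as $t\to\infty$.
   Context: For $d\in\mathbb{R}^n$, $A_d$ is the matrix defined by $A_dx:=Ax+N(x)d+N(d)x$ for all $x\in\mathbb{R}^n$. $B_r(d):=\{x\in\mathbb{R}^n:\|x-d\|_2\le r\}$. $\mathcal{S}^n$ is the set of real symmetric $n\times n$ matrices. For square (not necessarily symmetric) $M$: $M\succ0$ means $x^\top(M+M^\top)x>0$ for all $x\neq0$; $M\succeq0$ is the same with $\ge0$; $M\prec0$ (resp. $M\preceq0$) means $-M\succ0$ (resp. $-M\succeq0$). $S\oplus T:=\{s+t:s\in S,t\in T\}$ and $\alpha S:=\{\alpha s:s\in S\}$. A set $S$ is invariant for a (possibly time-varying) system if being in $S$ at a time $t_0\ge0$ implies being in $S$ for all $t\ge t_0$; invariance for the observer is understood for state trajectories with $x_0\in B_r(d)$. State semidefinite program (variables $s,t\in\mathbb{R}$, $z\in\mathbb{R}^n$): minimize $s$ subject to $$\begin{bmatrix}s & (Az)^\top \\ Az & sI_n\end{bmatrix}\succeq0,\quad tA+(A_z-A)+I\preceq0,\quad t\ge0,\quad Qz=0.$$ Given an optimal solution $(s^*,t^*,z^* )$, one takes $d=z^*/t^*$, $r=s^*$ (if $s^*=0$ and $z^*=0$, one takes $d=0$ and any $r>0$). Observer semidefinite program, for given $r,d,L$ (variables $s,t\in\mathbb{R}$, $z\in\mathbb{R}^n$): minimize $s$ subject to $$\begin{bmatrix}s-rt\|LC\|_2 &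 (LC(td-z)-Az)^\top \\ LC(td-z)-Az & (s-rt\|LC\|_2)I_n\end{bmatrix}\succeq0,\quad t(A+LC)+(A_z-A)+I\preceq0,\quad t\ge0,\quad Qz=0.$$ Given an optimal solution $(s^*,t^*,z^* )$, one takes $\hat d=z^*/t^*$, $\hat r=s^*$. *)

theory Defs
  imports "HOL-Analysis.Analysis"
begin

text \<open>Symmetry of the matrix is not required.\<close>

definition pos_def :: "real^'n^'n \<Rightarrow> bool" where
  "pos_def M \<longleftrightarrow> (\<forall>x. x \<noteq> 0 \<longrightarrow> x \<bullet> ((M + transpose M) *v x) > 0)"

definition pos_semidef :: "real^'n^'n \<Rightarrow> bool" where
  "pos_semidef M \<longleftrightarrow> (\<forall>x. x \<noteq> 0 \<longrightarrow> x \<bullet> ((M + transpose M) *v x) \<ge> 0)"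

definition neg_def :: "real^'n^'n \<Rightarrow> bool" where
  "neg_def M \<longleftrightarrow> pos_def (- M)"

definition neg_semidef :: "real^'n^'n \<Rightarrow> bool" where
  "neg_semidef M \<longleftrightarrow> pos_semidef (- M)"

definition block_mat ::
  "real^'a^'c \<Rightarrow> real^'b^'c \<Rightarrow> real^'a^'d \<Rightarrow> real^'b^'d \<Rightarrow> real^('a + 'b)^('c + 'd)" where
  "block_mat A B C D = (\<chi> i j.
     case i of
       Inl k \<Rightarrow> (case j of Inl l \<Rightarrow> A $ k $ l | Inr l \<Rightarrow> B $ k $ l)
     | Inr k \<Rightarrow> (case j of Inl l \<Rightarrow> C $ k $ l | Inr l \<Rightarrow> D $ k $ l))"

definition solves_ode :: "(real \<Rightarrow> real^'n \<Rightarrow> real^'n) \<Rightarrow> real set \<Rightarrow> (real \<Rightarrow> real^'n) \<Rightarrow> bool" where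
  "solves_ode f T x \<longleftrightarrow> (\<forall>t\<in>T. (x has_vector_derivative f t (x t)) (at t within T))"

text \<open>
  Invariance and stability quantify over solutions on compact intervals \<open>{t0..t1}\<close>, so that
  trajectories are covered for as long as they exist, and not only those already known to exist
  for all time.
\<close>

definition invariant_set :: "(real \<Rightarrow> real^'n \<Rightarrow> real^'n) \<Rightarrow> (real^'n) set \<Rightarrow> bool" where
  "invariant_set f S \<longleftrightarrow>
     (\<forall>t0\<ge>0. \<forall>t1\<ge>t0. \<forall>x. solves_ode f {t0..t1} x \<and> x t0 \<in> S \<longrightarrow> x t1 \<in> S)"

definition lyapunov_stable :: "(real \<Rightarrow> real^'n \<Rightarrow> real^'n) \<Rightarrow> bool" where
  "lyapunov_stable f \<longleftrightarrow>
     (\<forall>t0\<ge>0. \<forall>\<epsilon>>0. \<exists>\<delta>>0. \<forall>t1\<ge>t0. \<forall>w.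
        solves_ode f {t0..t1} w \<and> norm (w t0) < \<delta> \<longrightarrow> norm (w t1) < \<epsilon>)"

definition shifted_mat :: "real^'n^'n \<Rightarrow> (real^'n \<Rightarrow> real^'n^'n) \<Rightarrow> real^'n \<Rightarrow> real^'n^'n" where
  "shifted_mat A N d = matrix (\<lambda>x. A *v x + N x *v d + N d *v x)"

definition state_field ::
  "real^'n^'n \<Rightarrow> (real^'n \<Rightarrow> real^'n^'n) \<Rightarrow> real \<Rightarrow> real^'n \<Rightarrow> real^'n" where
  "state_field A N t x = A *v x + N x *v x"

definition observer_field ::
  "real^'n^'n \<Rightarrow> (real^'n \<Rightarrow> real^'n^'n) \<Rightarrow> real^'n^'p \<Rightarrow> real^'p^'n \<Rightarrow> (real \<Rightarrow> real^'n)
     \<Rightarrow> real \<Rightarrow> real^'n \<Rightarrow> real^'n" where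
  "observer_field A N C L x t xh = A *v xh + N xh *v xh - L *v (C *v x t - C *v xh)"

text \<open>The state trajectory enters the observer equation as an external signal.\<close>

definition observer_invariant ::
  "real^'n^'n \<Rightarrow> (real^'n \<Rightarrow> real^'n^'n) \<Rightarrow> real^'n^'p \<Rightarrow> real^'p^'n \<Rightarrow> real^'n \<Rightarrow> real
     \<Rightarrow> (real^'n) set \<Rightarrow> bool" where
  "observer_invariant A N C L d r S \<longleftrightarrow>
     (\<forall>x. solves_ode (state_field A N) {0..} x \<and> x 0 \<in> cball d r \<longrightarrow>
        invariant_set (observer_field A N C L x) S)"

definition spectral_norm :: "real^'n^'m \<Rightarrow> real" where
  "spectral_norm M = onorm ((*v) M)"

definition state_feasible ::
  "real^'n^'n \<Rightarrow> (real^'n \<Rightarrow> real^'n^'n) \<Rightarrow> real^'n^'n \<Rightarrow> real \<Rightarrow> real \<Rightarrow> real^'n \<Rightarrow> bool" where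
  "state_feasible A N Q s t z \<longleftrightarrow>
     pos_semidef (block_mat (mat s :: real^1^1) (rowvector (A *v z))
                            (columnvector (A *v z)) (mat s)) \<and>
     neg_semidef (t *\<^sub>R A + (shifted_mat A N z - A) + mat 1) \<and>
     t \<ge> 0 \<and> Q *v z = 0"

definition state_optimal ::
  "real^'n^'n \<Rightarrow> (real^'n \<Rightarrow> real^'n^'n) \<Rightarrow> real^'n^'n \<Rightarrow> real \<Rightarrow> real \<Rightarrow> real^'n \<Rightarrow> bool" where
  "state_optimal A N Q s t z \<longleftrightarrow>
     state_feasible A N Q s t z \<and> (\<forall>s' t' z'. state_feasible A N Q s' t' z' \<longrightarrow> s \<le> s')"

text \<open>
  Division by \<open>t\<close> is harmless: if \<open>t = 0\<close>, testing the second matrix inequality against \<open>z\<close>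
  gives \<open>z = 0\<close> (because \<open>N z z = 0\<close> on the kernel of \<open>Q\<close>), and then \<open>mat 1\<close> would be negative
  semidefinite. The same holds for the observer program.
\<close>

definition state_selected ::
  "real^'n^'n \<Rightarrow> (real^'n \<Rightarrow> real^'n^'n) \<Rightarrow> real^'n^'n \<Rightarrow> real^'n \<Rightarrow> real \<Rightarrow> bool" where
  "state_selected A N Q d r \<longleftrightarrow>
     (\<exists>s t z. state_optimal A N Q s t z \<and>
        (if s = 0 \<and> z = 0 then d = 0 \<and> r > 0 else d = z /\<^sub>R t \<and> r = s))"

definition observer_feasible ::
  "real^'n^'n \<Rightarrow> (real^'n \<Rightarrow> real^'n^'n) \<Rightarrow> real^'n^'n \<Rightarrow> real^'n^'p \<Rightarrow> real^'p^'n
     \<Rightarrow> real^'n \<Rightarrow> real \<Rightarrow> real \<Rightarrow> real \<Rightarrow> real^'n \<Rightarrow> bool" where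
  "observer_feasible A N Q C L d r s t z \<longleftrightarrow>
     (let \<sigma> = s - r * t * spectral_norm (L ** C);
          v = (L ** C) *v (t *\<^sub>R d - z) - A *v z
      in pos_semidef (block_mat (mat \<sigma> :: real^1^1) (rowvector v) (columnvector v) (mat \<sigma>))) \<and>
     neg_semidef (t *\<^sub>R (A + L ** C) + (shifted_mat A N z - A) + mat 1) \<and>
     t \<ge> 0 \<and> Q *v z = 0"

definition observer_optimal ::
  "real^'n^'n \<Rightarrow> (real^'n \<Rightarrow> real^'n^'n) \<Rightarrow> real^'n^'n \<Rightarrow> real^'n^'p \<Rightarrow> real^'p^'n
     \<Rightarrow> real^'n \<Rightarrow> real \<Rightarrow> real \<Rightarrow> real \<Rightarrow> real^'n \<Rightarrow> bool" where
  "observer_optimal A N Q C L d r s t z \<longleftrightarrow>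
     observer_feasible A N Q C L d r s t z \<and>
     (\<forall>s' t' z'. observer_feasible A N Q C L d r s' t' z' \<longrightarrow> s \<le> s')"

definition observer_selected ::
  "real^'n^'n \<Rightarrow> (real^'n \<Rightarrow> real^'n^'n) \<Rightarrow> real^'n^'n \<Rightarrow> real^'n^'p \<Rightarrow> real^'p^'n
     \<Rightarrow> real^'n \<Rightarrow> real \<Rightarrow> real^'n \<Rightarrow> real \<Rightarrow> bool" where
  "observer_selected A N Q C L d r dh rh \<longleftrightarrow>
     (\<exists>s t z. observer_optimal A N Q C L d r s t z \<and> dh = z /\<^sub>R t \<and> rh = s)"

end

theory Submission
  imports Defs
begin

text \<open>
  The function \<open>V w = w \<bullet> (P *v w)\<close> is a common quadratic Lyapunov function for all the linear
  systems met along the error trajectory.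

  Polarising the quadratic term \<open>N v *v v\<close> around the midpoint \<open>m t\<close> of \<open>x t\<close> and \<open>xh t\<close> turns
  the difference of the two nonlinear fields exactly, without remainder, into the linear
  time-varying system with matrix \<open>F (m t)\<close>, where \<open>F y = shifted_mat A N y + L ** C\<close>
  (\<open>error_field_eq\<close>). Since \<open>P ** L = R\<close>, the linear matrix inequality at \<open>y\<close> says that the
  quadratic form of \<open>P ** F y\<close> is negative definite (\<open>lmi_quadratic_form\<close>). Invariance of the two
  balls keeps \<open>m t\<close> in half their Minkowski sum, a compact subset of \<open>Y\<close>.

  Pointwise definiteness on \<open>Y\<close> would not suffice for convergence, because the decay rate could
  degenerate in time. On the compact set, however, a minimum over all matrices and unit vectors yields
  one constant valid for all times (\<open>quadratic_form_uniform\<close>). Then \<open>V\<close> decays exponentially along every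
  solution of the error equation (\<open>lyapunov_exponential_decay\<close>), and as \<open>V\<close> is comparable to the
  squared norm, this gives both stability and attractivity
  (\<open>lyapunov_stable_and_attractive\<close>).
\<close>

section \<open>Matrices and quadratic forms\<close>

text \<open>
  As \<open>matrix\<close> represents a function faithfully only if the function is linear, this needs the
  linearity of \<open>N\<close>.
\<close>

lemma shifted_mat_apply:
  fixes A :: "real^'n^'n"
  assumes "linear N"
  shows "shifted_mat A N y *v w = A *v w + N w *v y + N y *v w"
proof -
  have "linear (\<lambda>w. A *v w + N w *v y + N y *v w)"
    by (rule linearI)
       (simp_all add: linear_add[OF assms] linear_cmul[OF assms]
         scaleR_matrix_vector_assoc[symmetric] algebra_simps)
  then show ?thesis
    by (simp add: shifted_mat_def)
qed

lemma uminus_matrix_vector_mult: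
  fixes M :: "real^'n^'m"
  shows "(- M) *v x = - (M *v x)"
  using matrix_vector_mult_diff_rdistrib[of 0 M x] by simp

lemma inner_transpose:
  fixes M :: "real^'n^'m"
  shows "u \<bullet> (transpose M *v v) = (M *v u) \<bullet> v"
  by (metis dot_lmul_matrix inner_commute transpose_matrix_vector)

lemma inner_symmetric_part:
  fixes M :: "real^'n^'n"
  shows "x \<bullet> ((M + transpose M) *v x) = 2 * (x \<bullet> (M *v x))"
  by (simp add: matrix_vector_mult_add_rdistrib inner_add_right inner_transpose inner_commute
      del: transpose_matrix_vector)

lemma pos_def_iff: "pos_def M \<longleftrightarrow> (\<forall>x. x \<noteq> 0 \<longrightarrow> x \<bullet> (M *v x) > 0)"
  by (simp add: pos_def_def inner_symmetric_part)

lemma pos_def_inverse: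
  assumes "pos_def P"
  shows "P ** matrix_inv P = mat 1"
proof -
  have "\<forall>x. P *v x = 0 \<longrightarrow> x = 0"
    using assms by (metis inner_zero_right less_irrefl pos_def_iff)
  then have "invertible P"
    by (simp add: invertible_left_inverse matrix_left_invertible_ker)
  then show ?thesis
    by (metis (mono_tags, lifting) invertible_def matrix_inv_def someI_ex)
qed

lemma continuous_on_matrix_vector_mult:
  fixes F :: "'a::topological_space \<Rightarrow> real^'n^'m"
  assumes "continuous_on S F" "continuous_on S g"
  shows "continuous_on S (\<lambda>x. F x *v g x)"
  unfolding matrix_vector_mult_def using assms
  by (intro continuous_intros)

text \<open>
  By homogeneity it is enough to bound the form on unit vectors, and on the compact set
  \<open>K \<times> sphere 0 1\<close> its continuous values attain a minimum, which is positive.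
\<close>

lemma quadratic_form_uniform:
  fixes M :: "'a::t2_space \<Rightarrow> real^'n^'n"
  assumes K: "compact K" and cont: "continuous_on K M"
    and pos: "\<And>y w. y \<in> K \<Longrightarrow> w \<noteq> 0 \<Longrightarrow> 0 < w \<bullet> (M y *v w)"
  shows "\<exists>c>0. \<forall>y\<in>K. \<forall>w. c * (norm w)\<^sup>2 \<le> w \<bullet> (M y *v w)"
proof (cases "K = {}")
  case True
  then show ?thesis by (simp add: exI[of _ 1])
next
  case False
  define S where "S = K \<times> sphere (0::real^'n) 1"
  have "continuous_on S (\<lambda>p. snd p \<bullet> (M (fst p) *v snd p))"
    unfolding S_def
    by (intro continuous_intros continuous_on_matrix_vector_mult
          continuous_on_compose2[OF cont]) auto
  moreover have "compact S"
    using K by (simp add: S_def compact_Times)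
  moreover have "S \<noteq> {}"
    using False by (simp add: S_def)
  ultimately have "\<exists>p\<in>S. \<forall>q\<in>S.
      snd p \<bullet> (M (fst p) *v snd p) \<le> snd q \<bullet> (M (fst q) *v snd q)"
    by (intro continuous_attains_inf)
  then obtain p where p: "p \<in> S"
    and min: "\<And>q. q \<in> S \<Longrightarrow> snd p \<bullet> (M (fst p) *v snd p) \<le> snd q \<bullet> (M (fst q) *v snd q)"
    by blast
  define c where "c = snd p \<bullet> (M (fst p) *v snd p)"
  have "c > 0"
    using p unfolding c_def S_def by (intro pos) auto
  moreover have "c * (norm w)\<^sup>2 \<le> w \<bullet> (M y *v w)" if "y \<in> K" for y w
  proof (cases "w = 0")
    case False
    define u where "u = w /\<^sub>R norm w"
    have w: "w = norm w *\<^sub>R u" using False by (simp add: u_def)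
    have "(y, u) \<in> S" using that False by (simp add: S_def u_def)
    then have "c \<le> u \<bullet> (M y *v u)" using min[of "(y, u)"] by (simp add: c_def)
    then have "c * (norm w)\<^sup>2 \<le> (u \<bullet> (M y *v u)) * (norm w)\<^sup>2"
      by (intro mult_right_mono) auto
    also have "\<dots> = (norm w *\<^sub>R u) \<bullet> (M y *v (norm w *\<^sub>R u))"
      by (simp add: matrix_vector_mult_scaleR power2_eq_square)
    finally show ?thesis using w by simp
  qed simp
  ultimately show ?thesis by blast
qed

lemma continuous_on_shifted_mat:
  fixes A :: "real^'n^'n"
  assumes N: "linear N"
  shows "continuous_on S (shifted_mat A N)"
proof -
  define G where "G = (\<lambda>y. shifted_mat A N y - A)"
  have "G y *v w = N w *v y + N y *v w" for y w
    by (simp add: G_def matrix_vector_mult_diff_rdistrib shifted_mat_apply[OF N])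
  then have "linear G"
    by (intro linearI)
       (simp_all add: matrix_eq linear_add[OF N] linear_cmul[OF N]
         scaleR_matrix_vector_assoc[symmetric] algebra_simps)
  then have "continuous_on S (\<lambda>y. G y + A)"
    by (intro continuous_intros linear_continuous_on) (simp add: linear_conv_bounded_linear)
  then show ?thesis by (simp add: G_def)
qed

lemma continuous_on_matrix_matrix_mult:
  fixes F :: "'a::topological_space \<Rightarrow> real^'n^'m" and G :: "'a \<Rightarrow> real^'k^'n"
  assumes "continuous_on S F" "continuous_on S G"
  shows "continuous_on S (\<lambda>x. F x ** G x)"
  unfolding matrix_matrix_mult_def using assms
  by (intro continuous_intros)

text \<open>
  Both \<open>P ** S + transpose S ** P\<close> and the terms in \<open>R\<close> are a matrix plus its transpose, so the
  left-hand matrix is twice the symmetric part of \<open>P ** (S + L ** C)\<close>. The choice of \<open>R = P ** L\<close>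
  as unknown is what makes the inequality linear.
\<close>

lemma lmi_quadratic_form:
  assumes "pos_def P" "L = matrix_inv P ** R" and sym: "transpose P = P"
  shows "x \<bullet> ((P ** S + transpose S ** P + R ** C + transpose C ** transpose R) *v x)
    = 2 * (x \<bullet> (P *v ((S + L ** C) *v x)))"
proof -
  have R: "P ** L = R"
    using pos_def_inverse[OF assms(1)] by (simp add: assms(2) matrix_mul_assoc)
  have "transpose S ** P = transpose (P ** S)" "transpose C ** transpose R = transpose (R ** C)"
    by (simp_all add: matrix_transpose_mul sym)
  then have "P ** S + transpose S ** P + R ** C + transpose C ** transpose R
    = P ** (S + L ** C) + transpose (P ** (S + L ** C))"
    by (simp add: matrix_add_ldistrib matrix_mul_assoc R transpose_def vec_eq_iff)
  then show ?thesis
    by (simp only: inner_symmetric_part matrix_vector_mul_assoc)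
qed

section \<open>Quadratic Lyapunov functions for linear time-varying systems\<close>

lemma solves_ode_subset:
  assumes "solves_ode f T x" "S \<subseteq> T"
  shows "solves_ode f S x"
  using assms unfolding solves_ode_def
  by (auto intro: has_vector_derivative_within_subset)

lemma invariant_setD:
  assumes "invariant_set f S" "solves_ode f {0..} x" "x 0 \<in> S" "t \<ge> 0"
  shows "x t \<in> S"
  using assms(1,3,4) solves_ode_subset[OF assms(2), of "{0..t}"]
  unfolding invariant_set_def by auto

text \<open>
  With \<open>V t = w t \<bullet> (P *v w t)\<close> and \<open>k = 2 * c / q\<close>, the derivative of \<open>V\<close> is at most
  \<open>- 2 * c * (norm (w t))\<^sup>2 \<le> - k * V t\<close>, so \<open>exp (k * t) * V t\<close> does not increase. Only the open
  interval is used for derivatives, where the one-sided derivatives of \<open>solves_ode\<close> are ordinary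
  ones.
\<close>

lemma lyapunov_exponential_decay:
  fixes P :: "real^'n^'n" and F :: "real \<Rightarrow> real^'n^'n"
  assumes sym: "transpose P = P"
    and q: "q > 0" "\<And>u. u \<bullet> (P *v u) \<le> q * (norm u)\<^sup>2"
    and c: "c > 0"
    and decay: "\<And>t u. t0 < t \<Longrightarrow> t < t1 \<Longrightarrow> u \<bullet> (P *v (F t *v u)) \<le> - c * (norm u)\<^sup>2"
    and ode: "solves_ode (\<lambda>t u. F t *v u) {t0..t1} w" and t01: "t0 \<le> t1"
  shows "w t1 \<bullet> (P *v w t1) \<le> exp (- (2 * c / q) * (t1 - t0)) * (w t0 \<bullet> (P *v w t0))"
proof -
  define k where "k = 2 * c / q"
  define V where "V = (\<lambda>t. w t \<bullet> (P *v w t))"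
  define \<phi> where "\<phi> = (\<lambda>t. exp (k * t) * V t)"
  have wd: "(w has_vector_derivative F t *v w t) (at t within {t0..t1})" if "t \<in> {t0..t1}" for t
    using ode that by (simp add: solves_ode_def)
  have wc: "continuous_on {t0..t1} w"
    unfolding continuous_on_eq_continuous_within
    using wd has_vector_derivative_continuous by blast
  have "continuous_on {t0..t1} \<phi>"
    unfolding \<phi>_def V_def
    by (intro continuous_intros continuous_on_matrix_vector_mult wc)
  moreover have "\<exists>D. (\<phi> has_real_derivative D) (at t) \<and> D \<le> 0" if t: "t0 < t" "t < t1" for t
  proof -
    have w': "(w has_vector_derivative F t *v w t) (at t)"
      using wd[of t] t by (simp add: at_within_Icc_at)
    have Pw': "((\<lambda>t. P *v w t) has_vector_derivative P *v (F t *v w t)) (at t)"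
      by (rule bounded_linear.has_vector_derivative[OF matrix_vector_mul_bounded_linear w'])
    have "(V has_vector_derivative
        w t \<bullet> (P *v (F t *v w t)) + (F t *v w t) \<bullet> (P *v w t)) (at t)"
      unfolding V_def
      by (rule bounded_bilinear.has_vector_derivative[OF bounded_bilinear_inner w' Pw'])
    moreover have "(F t *v w t) \<bullet> (P *v w t) = w t \<bullet> (P *v (F t *v w t))"
      by (metis inner_commute inner_transpose sym)
    ultimately have V': "(V has_real_derivative 2 * (w t \<bullet> (P *v (F t *v w t)))) (at t)"
      by (simp add: has_real_derivative_iff_has_vector_derivative)
    have "(\<phi> has_real_derivative
        exp (k * t) * (k * V t + 2 * (w t \<bullet> (P *v (F t *v w t))))) (at t)"
      unfolding \<phi>_def by (auto intro!: derivative_eq_intros V' simp: algebra_simps)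
    moreover have "k * V t \<le> k * (q * (norm (w t))\<^sup>2)"
      unfolding V_def k_def using q c by (intro mult_left_mono) auto
    then have "k * V t + 2 * (w t \<bullet> (P *v (F t *v w t))) \<le> 0"
      using decay[OF t, of "w t"] q(1) by (simp add: k_def)
    then have "exp (k * t) * (k * V t + 2 * (w t \<bullet> (P *v (F t *v w t)))) \<le> 0"
      by (simp add: mult_le_0_iff)
    ultimately show ?thesis by blast
  qed
  ultimately have "exp (k * t1) * V t1 \<le> exp (k * t0) * V t0"
    using DERIV_nonpos_imp_decreasing_open[OF t01, of \<phi>] unfolding \<phi>_def by blast
  then have "exp (- k * t1) * (exp (k * t1) * V t1) \<le> exp (- k * t1) * (exp (k * t0) * V t0)"
    by (intro mult_left_mono) auto
  then have "V t1 \<le> exp (- k * t1 + k * t0) * V t0"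
    by (simp only: mult.assoc[symmetric] exp_add[symmetric]) simp
  moreover have "- k * t1 + k * t0 = - k * (t1 - t0)"
    by (simp add: algebra_simps)
  ultimately show ?thesis
    by (simp add: V_def k_def)
qed

text \<open>
  Since \<open>V\<close> lies between \<open>p * (norm u)\<^sup>2\<close> and \<open>q * (norm u)\<^sup>2\<close>, its exponential decay means that
  squared norms decay exponentially up to the factor \<open>q / p\<close>.
\<close>

lemma lyapunov_stable_and_attractive:
  fixes P :: "real^'n^'n" and F :: "real \<Rightarrow> real^'n^'n"
  assumes sym: "transpose P = P" and P: "pos_def P" and c: "c > 0"
    and decay: "\<And>t u. t \<ge> 0 \<Longrightarrow> u \<bullet> (P *v (F t *v u)) \<le> - c * (norm u)\<^sup>2"
  shows "lyapunov_stable (\<lambda>t u. F t *v u)"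
    and "solves_ode (\<lambda>t u. F t *v u) {0..} w \<Longrightarrow> (w \<longlongrightarrow> 0) at_top"
proof -
  \<comment> \<open>A constant family over a one-point set gives the lower bound on \<open>V\<close>.\<close>
  obtain p where p: "p > 0" "\<And>u. p * (norm u)\<^sup>2 \<le> u \<bullet> (P *v u)"
    using quadratic_form_uniform[OF compact_sing[of "0::real"] continuous_on_const, of P] P
    unfolding pos_def_iff by auto
  obtain q where q: "q > 0" "\<And>u. norm (P *v u) \<le> norm u * q"
    using bounded_linear.pos_bounded[OF matrix_vector_mul_bounded_linear[of P]] by blast
  have upper: "u \<bullet> (P *v u) \<le> q * (norm u)\<^sup>2" for u
  proof -
    have "u \<bullet> (P *v u) \<le> norm u * norm (P *v u)" by (rule norm_cauchy_schwarz)
    also have "\<dots> \<le> norm u * (norm u * q)" by (intro mult_left_mono q) simp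
    finally show ?thesis by (simp add: power2_eq_square algebra_simps)
  qed
  define k where "k = 2 * c / q"
  have k: "k > 0" using c q(1) by (simp add: k_def)
  have bound: "(norm (v t1))\<^sup>2 \<le> (q / p) * exp (- k * (t1 - t0)) * (norm (v t0))\<^sup>2"
    if "0 \<le> t0" "t0 \<le> t1" "solves_ode (\<lambda>t u. F t *v u) {t0..t1} v" for t0 t1 v
  proof -
    have "p * (norm (v t1))\<^sup>2 \<le> v t1 \<bullet> (P *v v t1)" by (rule p)
    also have "\<dots> \<le> exp (- k * (t1 - t0)) * (v t0 \<bullet> (P *v v t0))"
      unfolding k_def using that
      by (intro lyapunov_exponential_decay[OF sym q(1) upper c decay]) auto
    also have "\<dots> \<le> exp (- k * (t1 - t0)) * (q * (norm (v t0))\<^sup>2)"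
      by (intro mult_left_mono upper) simp
    finally show ?thesis using p(1) by (simp add: field_simps)
  qed
  show "lyapunov_stable (\<lambda>t u. F t *v u)"
    unfolding lyapunov_stable_def
  proof (intro allI impI)
    fix t0 \<epsilon> :: real assume t0: "t0 \<ge> 0" and \<epsilon>: "\<epsilon> > 0"
    \<comment> \<open>The factor \<open>q / p\<close> in the decay bound cancels against \<open>\<delta>\<^sup>2 = \<epsilon>\<^sup>2 * (p / q)\<close>.\<close>
    define \<delta> where "\<delta> = \<epsilon> * sqrt (p / q)"
    have "norm (v t1) < \<epsilon>"
      if "t1 \<ge> t0" "solves_ode (\<lambda>t u. F t *v u) {t0..t1} v" "norm (v t0) < \<delta>" for t1 v
    proof -
      have "(norm (v t1))\<^sup>2 \<le> (q / p) * exp (- k * (t1 - t0)) * (norm (v t0))\<^sup>2"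
        using bound t0 that by blast
      also have "\<dots> \<le> (q / p) * 1 * (norm (v t0))\<^sup>2"
        using p(1) q(1) k that(1) by (intro mult_left_mono mult_right_mono) auto
      also have "\<dots> < (q / p) * 1 * \<delta>\<^sup>2"
        using p(1) q(1) that(3) by (intro mult_strict_left_mono power_strict_mono) auto
      also have "\<dots> = \<epsilon>\<^sup>2"
        using p(1) q(1) by (simp add: \<delta>_def power_mult_distrib)
      finally show ?thesis using \<epsilon> by (simp add: power_less_imp_less_base)
    qed
    moreover have "\<delta> > 0" using \<epsilon> p(1) q(1) by (simp add: \<delta>_def)
    ultimately show "\<exists>\<delta>>0. \<forall>t1\<ge>t0. \<forall>w. solves_ode (\<lambda>t u. F t *v u) {t0..t1} w \<and>
        norm (w t0) < \<delta> \<longrightarrow> norm (w t1) < \<epsilon>"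
      by blast
  qed
  show "(w \<longlongrightarrow> 0) at_top" if w: "solves_ode (\<lambda>t u. F t *v u) {0..} w"
  proof -
    have "((\<lambda>t. exp (- k * (t - 0))) \<longlongrightarrow> 0) at_top"
      using k
      by (intro filterlim_compose[OF exp_at_bot]
          filterlim_tendsto_neg_mult_at_bot[where c = "- k"] tendsto_const)
         (simp_all add: filterlim_ident)
    then have "((\<lambda>t. (q / p) * exp (- k * (t - 0)) * (norm (w 0))\<^sup>2) \<longlongrightarrow>
        (q / p) * 0 * (norm (w 0))\<^sup>2) at_top"
      by (intro tendsto_intros)
    then have lim: "((\<lambda>t. (q / p) * exp (- k * (t - 0)) * (norm (w 0))\<^sup>2) \<longlongrightarrow> 0) at_top"
      by simp
    have "(norm (w t))\<^sup>2 \<le> (q / p) * exp (- k * (t - 0)) * (norm (w 0))\<^sup>2" if "t \<ge> 0" for t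
      using that by (intro bound solves_ode_subset[OF w]) auto
    then have "\<forall>\<^sub>F t in at_top. (norm (w t))\<^sup>2 \<le> (q / p) * exp (- k * (t - 0)) * (norm (w 0))\<^sup>2"
      by (rule eventually_mono[OF eventually_ge_at_top])
    then have "((\<lambda>t. (norm (w t))\<^sup>2) \<longlongrightarrow> 0) at_top"
      by (intro tendsto_sandwich[OF _ _ tendsto_const lim]) auto
    then have "((\<lambda>t. sqrt ((norm (w t))\<^sup>2)) \<longlongrightarrow> sqrt 0) at_top"
      by (rule tendsto_real_sqrt)
    then show ?thesis by (simp add: tendsto_norm_zero_iff)
  qed
qed

section \<open>The observer error\<close>

text \<open>
  For a quadratic map with polar form \<open>N v *v u + N u *v v\<close>, the difference of its values at two
  points is the polar form evaluated at their midpoint and their difference. This is why the matrix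
  is shifted by the midpoint.
\<close>

lemma error_field_eq:
  assumes N: "linear N"
  shows "state_field A N t (x t) - observer_field A N C L x t u
     = (shifted_mat A N ((1/2) *\<^sub>R (x t + u)) + L ** C) *v (x t - u)"
  by (simp add: shifted_mat_apply[OF N] state_field_def observer_field_def linear_add[OF N]
      linear_diff[OF N] linear_cmul[OF N] scaleR_matrix_vector_assoc[symmetric]
      matrix_vector_mul_assoc[symmetric] algebra_simps)

theorem mainTheorem2:
  fixes A Q P :: "real^'n^'n" and C :: "real^'n^'p" and N :: "real^'n \<Rightarrow> real^'n^'n"
    and R L :: "real^'p^'n" and d dh x0 xh0 :: "real^'n" and r rh \<alpha>1 \<alpha>2 :: real
    and Y :: "(real^'n) set" and x xh e :: "real \<Rightarrow> real^'n"
  assumes N_linear: "linear N"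
    and N_energy: "\<And>v. v \<bullet> (N v *v v) = 0"
    and Q_kernel: "\<And>v. Q *v v = 0 \<Longrightarrow> N v *v v = 0"
    and r_pos: "r > 0"
    and state_selection: "state_selected A N Q d r"
    and state_invariance: "invariant_set (state_field A N) (cball d r)"
    and alphas: "\<alpha>1 \<ge> 0" "\<alpha>2 \<ge> 0"
    and ball_Y: "cball d r \<subset> Y"
    and P_sym: "transpose P = P"
    and P_pos: "pos_def P"
    and P_lower: "pos_def (P - mat \<alpha>1)"
    and RC_bound: "pos_semidef (block_mat (mat \<alpha>2) (R ** C) (transpose (R ** C)) (mat \<alpha>2))"
    and LMI: "\<And>y. y \<in> Y \<Longrightarrow>
      neg_def (P ** shifted_mat A N y + transpose (shifted_mat A N y) ** P
               + R ** C + transpose C ** transpose R)"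
    and L_eq: "L = matrix_inv P ** R"
    and rh_pos: "rh > 0"
    and observer_selection: "observer_selected A N Q C L d r dh rh"
    and observer_invariance: "observer_invariant A N C L d r (cball dh rh)"
    and x_solves: "solves_ode (state_field A N) {0..} x"
    and x_init: "x 0 = x0" "x0 \<in> cball d r"
    and xh_solves: "solves_ode (observer_field A N C L x) {0..} xh"
    and xh_init: "xh 0 = xh0"
    and e_eq: "e = (\<lambda>t. x t - xh t)"
    and balls_Y: "(\<lambda>v. (1/2) *\<^sub>R v) ` {u + v | u v. u \<in> cball d r \<and> v \<in> cball dh rh} \<subseteq> Y"
    and xh0_ball: "xh0 \<in> cball dh rh"
  defines "error_field \<equiv>
    (\<lambda>t w. (shifted_mat A N ((1/2) *\<^sub>R (x t + xh t)) + L ** C) *v w)"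
  shows "solves_ode error_field {0..} e \<and> lyapunov_stable error_field \<and> (e \<longlongrightarrow> 0) at_top"
proof -
  define K where "K = (\<lambda>v. (1/2) *\<^sub>R v) ` {u + v | u v. u \<in> cball d r \<and> v \<in> cball dh rh}"
  define F where "F = (\<lambda>y. shifted_mat A N y + L ** C)"
  have x_in: "x t \<in> cball d r" if "t \<ge> 0" for t
    using x_init by (intro invariant_setD[OF state_invariance x_solves _ that]) simp
  have xh_invariance: "invariant_set (observer_field A N C L x) (cball dh rh)"
    using observer_invariance x_solves x_init unfolding observer_invariant_def by simp
  have xh_in: "xh t \<in> cball dh rh" if "t \<ge> 0" for t
    using xh_init xh0_ball by (intro invariant_setD[OF xh_invariance xh_solves _ that]) simp
  have mid_in: "(1/2) *\<^sub>R (x t + xh t) \<in> K" if "t \<ge> 0" for t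
    unfolding K_def
    by (intro imageI CollectI exI[of _ "x t"] exI[of _ "xh t"] conjI refl x_in xh_in that)

  have "compact K"
    unfolding K_def by (intro compact_scaling compact_sums compact_cball)
  moreover have "continuous_on K (\<lambda>y. - (P ** F y))"
    unfolding F_def
    by (intro continuous_intros continuous_on_matrix_matrix_mult continuous_on_shifted_mat
        N_linear)
  moreover have "0 < w \<bullet> (- (P ** F y) *v w)" if "y \<in> K" "w \<noteq> 0" for y w
  proof -
    have "y \<in> Y" using balls_Y that(1) unfolding K_def by (rule subsetD)
    from LMI[OF this] that(2) show ?thesis
      unfolding neg_def_def pos_def_iff
      by (simp only: uminus_matrix_vector_mult lmi_quadratic_form[OF P_pos L_eq P_sym] F_def
          matrix_vector_mul_assoc[symmetric] inner_minus_right) force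
  qed
  ultimately have "\<exists>c>0. \<forall>y\<in>K. \<forall>w. c * (norm w)\<^sup>2 \<le> w \<bullet> (- (P ** F y) *v w)"
    by (rule quadratic_form_uniform)
  then obtain c where c: "c > 0"
    "\<And>y w. y \<in> K \<Longrightarrow> c * (norm w)\<^sup>2 \<le> w \<bullet> (- (P ** F y) *v w)"
    by metis
  have decay: "w \<bullet> (P *v (F ((1/2) *\<^sub>R (x t + xh t)) *v w)) \<le> - c * (norm w)\<^sup>2"
    if "t \<ge> 0" for t w
    using c(2)[OF mid_in[OF that], of w]
    by (simp add: uminus_matrix_vector_mult matrix_vector_mul_assoc)

  have ode: "solves_ode error_field {0..} e"
    using x_solves xh_solves
    unfolding solves_ode_def error_field_def e_eq error_field_eq[OF N_linear, symmetric]
    by (auto intro: has_vector_derivative_diff)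
  have ef: "error_field = (\<lambda>t w. F ((1/2) *\<^sub>R (x t + xh t)) *v w)"
    by (simp add: error_field_def F_def)
  show ?thesis
    using ode lyapunov_stable_and_attractive[OF P_sym P_pos c(1) decay] unfolding ef by simp
qed

end
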